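(* Let $m\ge 1$ be an integer and let $p_1,\dots,p_m>0$ with $\sum_{i=1}^m p_i=1$. For each $n\ge 1$ let $Y=(Y_1,\dots,Y_n)$ be a vector of i.i.d. random variables with $P(Y_j=i)=p_i$ for all $i\in[m]$ and $j\in[n]$, let $\mathcal N_n$ be the empirical nerve of $Y$, and let $\omega_n$ be the clique number of the 1-skeleton of $\mathcal N_n$. Then, as $n\to\infty$, $\mathbb E\,\omega_n\to m$, the clique number $\omega_n$ converges to $m$ in probability, and $$\lim_{n\to\infty}P(\mathcal N_n=\Delta_{m-1})=1,$$ where $\Delta_{m-1}$ denotes the $(m-1)$-simplex on vertex set $[m]$ (equivalently, the probability that the graph of $\mathcal N_n$ is the complete graph $K_m$ tends to $1$).
   Context: Notation: $[N]=\{1,\dots,N\}$. For each label $i\in[m]$, the empirical support is $I_n(i)=\mathrm{Conv}(\{j\in[n]:Y_j=i\})\subset\mathbb R$, i.e. the closed interval from the first to the last index at which label $i$ occurs (possibly a single point; empty if label $i$ does not occur). The empirical nerve $\mathcal N_n$ is the abstract simplicial complex whose simplices are the nonempty subsets $J\subseteq[m]$ with $\bigcap_{i\in J}I_n(i)\ne\emptyset$; its 1-skeleton (its graph) has as vertices the labels $i$ with $I_n(i)\neq\emptyset$, with $\{i,j\}$, $i\ne j$, an edge iff $I_n(i)\cap I_n(j)\neq\emptyset$. The clique number of a graph is the number of vertices of its largest clique. $\mathcal N_n=\Delta_{m-1}$ means $\bigcap_{i=1}^m I_n(i)\neq\emptyset$. *)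

theory Defs
  imports "HOL-Probability.Probability" "HOL-Library.Ramsey"
begin

definition empirical_support :: "nat \<Rightarrow> (nat \<Rightarrow> nat) \<Rightarrow> nat \<Rightarrow> real set" where
  "empirical_support n y i = convex hull (real ` {j \<in> {1..n}. y j = i})"

text \<open>An abstract simplicial complex is represented by the set of its (nonempty) simplices.\<close>

definition nerve :: "'i set \<Rightarrow> ('i \<Rightarrow> 'b set) \<Rightarrow> 'i set set" where
  "nerve L I = {J. J \<noteq> {} \<and> J \<subseteq> L \<and> (\<Inter>i\<in>J. I i) \<noteq> {}}"

definition empirical_nerve :: "nat \<Rightarrow> nat \<Rightarrow> (nat \<Rightarrow> nat) \<Rightarrow> nat set set" where
  "empirical_nerve m n y = nerve {1..m} (empirical_support n y)"

definition full_simplex :: "'i set \<Rightarrow> 'i set set" where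
  "full_simplex V = {J. J \<noteq> {} \<and> J \<subseteq> V}"

text \<open>Graphs are pairs consisting of a vertex set and a set of two-element edges.\<close>

definition skeleton1 :: "'i set set \<Rightarrow> 'i set \<times> 'i set set" where
  "skeleton1 K = ({v. {v} \<in> K}, {e \<in> K. card e = 2})"

definition complete_graph_on :: "'i set \<Rightarrow> 'i set \<times> 'i set set" where
  "complete_graph_on V = (V, nsets V 2)"

definition clique_number :: "'i set \<times> 'i set set \<Rightarrow> nat" where
  "clique_number G = Max {card C | C. C \<subseteq> fst G \<and> finite C \<and> clique C (snd G)}"

text \<open>Each \<open>X n\<close> may live on its own probability space \<open>M n\<close>, which suffices for
  convergence in probability to a constant.\<close>

definition converges_in_prob_to_const ::
    "(nat \<Rightarrow> 'a measure) \<Rightarrow> (nat \<Rightarrow> 'a \<Rightarrow> real) \<Rightarrow> real \<Rightarrow> bool" where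
  "converges_in_prob_to_const M X c \<longleftrightarrow>
     (\<forall>n. X n \<in> borel_measurable (M n)) \<and>
     (\<forall>\<epsilon>>0. (\<lambda>n. \<P>(x in M n. \<bar>X n x - c\<bar> > \<epsilon>)) \<longlonglongrightarrow> 0)"

lemma empirical_nerve_eq_full_simplex_iff:
  assumes "m \<ge> 1"
  shows "empirical_nerve m n y = full_simplex {1..m} \<longleftrightarrow>
         (\<Inter>i\<in>{1..m}. empirical_support n y i) \<noteq> {}"
proof
  assume "empirical_nerve m n y = full_simplex {1..m}"
  moreover have "{1..m} \<in> full_simplex {1..m}"
    using assms by (simp add: full_simplex_def)
  ultimately show "(\<Inter>i\<in>{1..m}. empirical_support n y i) \<noteq> {}"
    unfolding empirical_nerve_def nerve_def by blast
next
  assume "(\<Inter>i\<in>{1..m}. empirical_support n y i) \<noteq> {}"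
  then show "empirical_nerve m n y = full_simplex {1..m}"
    unfolding empirical_nerve_def nerve_def full_simplex_def by blast
qed

lemma fst_skeleton1_empirical_nerve:
  "fst (skeleton1 (empirical_nerve m n y)) = {i \<in> {1..m}. empirical_support n y i \<noteq> {}}"
  by (auto simp: skeleton1_def empirical_nerve_def nerve_def)

lemma snd_skeleton1_empirical_nerve:
  assumes "i \<in> {1..m}" "j \<in> {1..m}" "i \<noteq> j"
  shows "{i, j} \<in> snd (skeleton1 (empirical_nerve m n y)) \<longleftrightarrow>
         empirical_support n y i \<inter> empirical_support n y j \<noteq> {}"
  using assms by (auto simp: skeleton1_def empirical_nerve_def nerve_def)

end

(* If every label occurs both in the first and in the second half of the sample, then every
   empirical support contains the midpoint of [n], so the nerve is the full simplex. A fixed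
   label i misses one of the halves with probability at most 2 (1 - p_i)^(n div 2), which tends
   to 0, so a union bound over the finitely many labels gives the convergence of the nerve.
   Since 0 <= \<omega>_n <= m, with \<omega>_n = m on that event, the other claims follow by squeezing. *)
theory Submission
  imports Defs
begin

section \<open>Intervals and nerves of a fixed sample\<close>

text \<open>Convexity: the support contains the whole segment between any two occurrences of
  \<open>i\<close>.\<close>

lemma mem_empirical_support_if_straddled:
  assumes "a \<in> {1..n}" "b \<in> {1..n}" "y a = i" "y b = i" "real a \<le> t" "t \<le> real b"
  shows "t \<in> empirical_support n y i"
proof -
  have "convex hull {real a, real b} \<subseteq> empirical_support n y i"
    unfolding empirical_support_def using assms by (intro hull_mono) auto
  moreover have "t \<in> closed_segment (real a) (real b)"
    using assms by (simp add: closed_segment_eq_real_ivl)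
  ultimately show ?thesis
    by (auto simp: segment_convex_hull)
qed

text \<open>The cut position \<open>k\<close> itself is a common point of all supports: each label
  occurs at or before \<open>k\<close> and again after it.\<close>

lemma empirical_nerve_eq_full_simplex_if_straddled:
  assumes "m \<ge> 1" "k \<le> n"
    and "\<And>i. i \<in> {1..m} \<Longrightarrow> \<exists>a\<in>{1..k}. y a = i"
    and "\<And>i. i \<in> {1..m} \<Longrightarrow> \<exists>b\<in>{k<..n}. y b = i"
  shows "empirical_nerve m n y = full_simplex {1..m}"
proof -
  have "real k \<in> empirical_support n y i" if i: "i \<in> {1..m}" for i
  proof -
    obtain a b where "a \<in> {1..k}" "y a = i" "b \<in> {k<..n}" "y b = i"
      using assms(3,4)[OF i] by blast
    then show ?thesis
      using assms(2) by (intro mem_empirical_support_if_straddled[of a n b]) auto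
  qed
  then show ?thesis
    unfolding empirical_nerve_eq_full_simplex_iff[OF assms(1)] by blast
qed

section \<open>Skeletons and clique numbers\<close>

lemma skeleton1_full_simplex:
  "skeleton1 (full_simplex V) = complete_graph_on V"
proof -
  \<comment> \<open>\<open>nsets\<close> asks for finite sets and \<open>full_simplex\<close> for
    nonempty ones; cardinality 2 gives both, since infinite sets have cardinality 0 by
    convention.\<close>
  have "finite e \<and> e \<noteq> {}" if "card e = 2" for e :: "'a set"
    using that card.infinite[of e] by auto
  then show ?thesis
    by (auto simp: skeleton1_def full_simplex_def complete_graph_on_def nsets_def)
qed

lemma clique_number_le:
  assumes "finite V" "fst G \<subseteq> V"
  shows "clique_number G \<le> card V"
proof -
  let ?S = "{card C | C. C \<subseteq> fst G \<and> finite C \<and> clique C (snd G)}"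
  have sub: "?S \<subseteq> {..card V}"
    using card_mono[OF assms(1)] assms(2) by blast
  \<comment> \<open>The empty clique makes \<open>?S\<close> nonempty, so that \<open>Max\<close> is
    attained.\<close>
  have "card {} \<in> ?S"
    by (intro CollectI exI[of _ "{}"]) (simp add: clique_def)
  then have "Max ?S \<in> ?S"
    using finite_subset[OF sub] by (intro Max_in) blast+
  with sub show ?thesis
    by (auto simp: clique_number_def)
qed

lemma clique_number_complete_graph_on:
  assumes "finite V"
  shows "clique_number (complete_graph_on V) = card V"
proof (rule antisym)
  show "clique_number (complete_graph_on V) \<le> card V"
    using assms by (intro clique_number_le) (simp_all add: complete_graph_on_def)
  let ?S = "{card C | C. C \<subseteq> V \<and> finite C \<and> clique C (nsets V 2)}"
  have "finite ?S"
    using card_mono[OF assms] by (intro finite_subset[of ?S "{..card V}"]) auto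
  moreover have "clique V (nsets V 2)"
    by (simp add: clique_def doubleton_in_nsets_2)
  then have "card V \<in> ?S"
    using assms by (intro CollectI exI[of _ V]) simp
  ultimately show "card V \<le> clique_number (complete_graph_on V)"
    by (simp add: clique_number_def complete_graph_on_def)
qed

text \<open>Supplies the dependence on finitely many coordinates from which measurability of the
  nerve follows.\<close>

lemma empirical_nerve_cong:
  assumes "\<And>j. j \<in> {1..n} \<Longrightarrow> y j = y' j"
  shows "empirical_nerve m n y = empirical_nerve m n y'"
proof -
  have "{j \<in> {1..n}. y j = i} = {j \<in> {1..n}. y' j = i}" for i
    using assms by auto
  then show ?thesis
    by (simp add: empirical_nerve_def empirical_support_def[abs_def])
qed

lemma clique_number_empirical_nerve_le:
  "clique_number (skeleton1 (empirical_nerve m n y)) \<le> m"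
proof -
  have "fst (skeleton1 (empirical_nerve m n y)) \<subseteq> {1..m}"
    by (auto simp: fst_skeleton1_empirical_nerve)
  from clique_number_le[OF finite_atLeastAtMost this] show ?thesis
    by simp
qed

section \<open>Measurability\<close>

text \<open>Since \<open>F\<close> only sees the coordinates in \<open>J\<close>, it can be applied
  to the restriction \<open>?R\<close>, whose values lie in the finite set
  \<open>J \<rightarrow>\<^sub>E S\<close>. With the discrete sigma-algebra there, every function of
  \<open>?R\<close> is measurable.\<close>

lemma measurable_function_of_finitely_many_discrete:
  assumes "finite J" "finite S"
    and Y: "\<And>j. j \<in> J \<Longrightarrow> Y j \<in> M \<rightarrow>\<^sub>M count_space S"
    and F: "\<And>y y'. (\<And>j. j \<in> J \<Longrightarrow> y j = y' j) \<Longrightarrow> F y = F y'"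
  shows "(\<lambda>x. F (\<lambda>j. Y j x)) \<in> M \<rightarrow>\<^sub>M count_space UNIV"
proof -
  let ?R = "\<lambda>x. \<lambda>j\<in>J. Y j x"
  have "?R \<in> M \<rightarrow>\<^sub>M count_space (J \<rightarrow>\<^sub>E S)"
  \<comment> \<open>For a finite target it is enough to treat preimages of single points, each a
    finite conjunction of events \<open>Y j x = g j\<close>.\<close>
  proof (subst measurable_count_space_eq2)
    show "finite (J \<rightarrow>\<^sub>E S)"
      using assms by (intro finite_PiE) auto
    have "?R -` {g} \<inter> space M \<in> sets M" if g: "g \<in> J \<rightarrow>\<^sub>E S" for g
    proof -
      have "?R -` {g} \<inter> space M = {x \<in> space M. \<forall>j\<in>J. Y j x = g j}"
        using g by (auto simp: fun_eq_iff PiE_def extensional_def restrict_def)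
      also have "\<dots> \<in> sets M"
      proof (rule sets.sets_Collect_finite_All)
        fix j assume "j \<in> J"
        then have "Y j -` {g j} \<inter> space M \<in> sets M"
          using g by (intro measurable_sets[OF Y]) auto
        also have "Y j -` {g j} \<inter> space M = {x \<in> space M. Y j x = g j}"
          by auto
        finally show "{x \<in> space M. Y j x = g j} \<in> sets M" .
      qed (rule assms)
      finally show ?thesis .
    qed
    moreover have "?R \<in> space M \<rightarrow> (J \<rightarrow>\<^sub>E S)"
      using measurable_space[OF Y] by auto
    ultimately show "?R \<in> space M \<rightarrow> (J \<rightarrow>\<^sub>E S) \<and>
        (\<forall>g\<in>J \<rightarrow>\<^sub>E S. ?R -` {g} \<inter> space M \<in> sets M)"
      by blast
  qed
  then have "(\<lambda>x. F (?R x)) \<in> M \<rightarrow>\<^sub>M count_space UNIV"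
    by (rule measurable_compose) simp
  moreover have "F (?R x) = F (\<lambda>j. Y j x)" for x
    by (rule F) simp
  ultimately show ?thesis
    by simp
qed

section \<open>Probability bounds\<close>

text \<open>By independence the probability is a product over \<open>A\<close>, each factor being
  that of the complement of an event of probability \<open>q\<close>.\<close>

lemma (in prob_space) prob_value_missed:
  assumes indep: "indep_vars (\<lambda>_. count_space S) Y J"
    and "i \<in> S" "A \<subseteq> J" "finite A"
    and prob: "\<And>j. j \<in> A \<Longrightarrow> \<P>(x in M. Y j x = i) = q"
  shows "\<P>(x in M. \<forall>j\<in>A. Y j x \<noteq> i) = (1 - q) ^ card A"
proof (cases "A = {}")
  case True
  then show ?thesis
    by (simp add: prob_space)
next
  case False
  have Y: "Y j \<in> M \<rightarrow>\<^sub>M count_space S" if "j \<in> A" for j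
    using indep that assms(3) by (auto simp: indep_vars_def2)
  have S: "Y j x \<in> S" if "j \<in> A" "x \<in> space M" for j x
    using measurable_space[OF Y[OF that(1)] that(2)] by simp
  \<comment> \<open>The complement is taken within \<open>S\<close>, so that the event is the
    preimage of a set of \<open>count_space S\<close>, as \<open>indep_varsD\<close>
    requires.\<close>
  have one: "prob (Y j -` (S - {i}) \<inter> space M) = 1 - q" if j: "j \<in> A" for j
  proof -
    have "Y j -` {i} \<inter> space M \<in> events"
      using \<open>i \<in> S\<close> by (intro measurable_sets[OF Y[OF j]]) auto
    then have "prob (space M - (Y j -` {i} \<inter> space M)) = 1 - prob (Y j -` {i} \<inter> space M)"
      by (rule prob_compl)
    moreover have "Y j -` {i} \<inter> space M = {x \<in> space M. Y j x = i}"
      by auto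
    moreover have "space M - (Y j -` {i} \<inter> space M) = Y j -` (S - {i}) \<inter> space M"
      using S[OF j] by auto
    ultimately show ?thesis
      using prob[OF j] by simp
  qed
  \<comment> \<open>Nonemptiness of \<open>A\<close> matters: an empty intersection would be
    \<open>UNIV\<close> in place of \<open>space M\<close>.\<close>
  have "{x \<in> space M. \<forall>j\<in>A. Y j x \<noteq> i} = (\<Inter>j\<in>A. Y j -` (S - {i}) \<inter> space M)"
    using False S by auto
  then have "\<P>(x in M. \<forall>j\<in>A. Y j x \<noteq> i) = prob (\<Inter>j\<in>A. Y j -` (S - {i}) \<inter> space M)"
    by simp
  also have "\<dots> = (\<Prod>j\<in>A. prob (Y j -` (S - {i}) \<inter> space M))"
    using False \<open>A \<subseteq> J\<close> \<open>finite A\<close> by (intro indep_varsD[OF indep]) simp_all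
  also have "\<dots> = (1 - q) ^ card A"
    using one by simp
  finally show ?thesis .
qed

text \<open>Union bound over pairs of a label and a half of the sample; the factor 2 counts the
  halves. For \<open>n < 2\<close> the left side is negative and the bound is trivial.\<close>

lemma (in prob_space) prob_empirical_nerve_full_ge:
  assumes "m \<ge> 1"
    and indep: "indep_vars (\<lambda>_. count_space {1..m}) Y {1..n}"
    and prob: "\<And>j i. j \<in> {1..n} \<Longrightarrow> i \<in> {1..m} \<Longrightarrow> \<P>(x in M. Y j x = i) = p i"
  shows "1 - 2 * (\<Sum>i=1..m. (1 - p i) ^ (n div 2))
    \<le> \<P>(x in M. empirical_nerve m n (\<lambda>j. Y j x) = full_simplex {1..m})"
proof -
  let ?k = "n div 2"
  let ?G = "{x \<in> space M. empirical_nerve m n (\<lambda>j. Y j x) = full_simplex {1..m}}"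
  let ?B = "\<lambda>A i. {x \<in> space M. \<forall>j\<in>A. Y j x \<noteq> i}"
  have Y: "Y j \<in> M \<rightarrow>\<^sub>M count_space {1..m}" if "j \<in> {1..n}" for j
    using indep that by (auto simp: indep_vars_def2)
  have events: "{x \<in> space M. P (\<lambda>j. Y j x)} \<in> events"
    if P: "\<And>y y'. (\<And>j. j \<in> {1..n} \<Longrightarrow> y j = y' j) \<Longrightarrow> P y = P y'" for P
  proof -
    have "Measurable.pred M (\<lambda>x. P (\<lambda>j. Y j x))"
    proof (rule measurable_function_of_finitely_many_discrete
        [where J = "{1..n}" and S = "{1..m}" and F = P])
      show "Y j \<in> M \<rightarrow>\<^sub>M count_space {1..m}" if "j \<in> {1..n}" for j
        by (rule Y[OF that])
      show "P y = P y'" if "\<And>j. j \<in> {1..n} \<Longrightarrow> y j = y' j" for y y'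
        by (rule P[OF that])
    qed simp_all
    then show ?thesis
      by (simp add: pred_def)
  qed
  have G: "?G \<in> events"
  proof (rule events[of "\<lambda>y. empirical_nerve m n y = full_simplex {1..m}"])
    show "(empirical_nerve m n y = full_simplex {1..m}) = (empirical_nerve m n y' = full_simplex {1..m})"
      if "\<And>j. j \<in> {1..n} \<Longrightarrow> y j = y' j" for y y'
      using empirical_nerve_cong[of n y y' m, OF that] by simp
  qed
  have B: "?B A i \<in> events" if "A \<subseteq> {1..n}" for A i
  proof (rule events[of "\<lambda>y. \<forall>j\<in>A. y j \<noteq> i"])
    show "(\<forall>j\<in>A. y j \<noteq> i) = (\<forall>j\<in>A. y' j \<noteq> i)"
      if "\<And>j. j \<in> {1..n} \<Longrightarrow> y j = y' j" for y y' :: "nat \<Rightarrow> nat"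
      by (rule ball_cong) (use that \<open>A \<subseteq> {1..n}\<close> in auto)
  qed
  \<comment> \<open>Covers both halves at once: the lower one has \<open>?k\<close> indices, the
    upper one \<open>n - ?k\<close>, which is one more when \<open>n\<close> is odd.\<close>
  have pB: "prob (?B A i) \<le> (1 - p i) ^ ?k"
    if A: "A \<subseteq> {1..n}" and i: "i \<in> {1..m}" and k: "?k \<le> card A" for A i
  proof (cases "A = {}")
    case True
    with k show ?thesis
      by simp
  next
    case False
    then obtain j where j: "j \<in> {1..n}"
      using A by blast
    \<comment> \<open>An index \<open>j\<close> in \<open>A\<close> exhibits \<open>p i\<close> as a
      probability, and powers of \<open>1 - p i\<close> then decrease in the exponent. For empty
      \<open>A\<close>, treated above, \<open>?k\<close> is 0 and the bound is 1.\<close>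
    have "0 \<le> p i" "p i \<le> 1"
      unfolding prob[OF j i, symmetric] by simp_all
    moreover have "prob (?B A i) = (1 - p i) ^ card A"
      using A i by (intro prob_value_missed[OF indep] prob finite_subset[OF A]) auto
    ultimately show ?thesis
      using k by (simp add: power_decreasing)
  qed
  let ?U = "\<lambda>i. ?B {1..?k} i \<union> ?B {?k<..n} i"
  have U: "?U i \<in> events" for i
    by (intro sets.Un) (rule B; auto)+
  \<comment> \<open>Contrapositive of the straddling criterion: off all \<open>?U i\<close>, every
    label is hit on both sides of \<open>?k\<close>, so the nerve is full.\<close>
  have "space M - ?G \<subseteq> (\<Union>i\<in>{1..m}. ?U i)"
  proof
    fix x assume x: "x \<in> space M - ?G"
    show "x \<in> (\<Union>i\<in>{1..m}. ?U i)"
    proof (rule ccontr)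
      assume hit: "x \<notin> (\<Union>i\<in>{1..m}. ?U i)"
      have "empirical_nerve m n (\<lambda>j. Y j x) = full_simplex {1..m}"
      proof (rule empirical_nerve_eq_full_simplex_if_straddled[of m ?k])
        show "\<exists>a\<in>{1..?k}. Y a x = i" "\<exists>b\<in>{?k<..n}. Y b x = i" if "i \<in> {1..m}" for i
          using hit x that by blast+
      qed (use assms(1) in auto)
      with x show False
        by blast
    qed
  qed
  then have 1: "prob (space M - ?G) \<le> prob (\<Union>i\<in>{1..m}. ?U i)"
    by (rule finite_measure_mono) (intro sets.finite_UN U finite_atLeastAtMost)
  have 2: "prob (\<Union>i\<in>{1..m}. ?U i) \<le> (\<Sum>i=1..m. prob (?U i))"
    using U by (intro finite_measure_subadditive_finite) blast+
  have 3: "(\<Sum>i=1..m. prob (?U i)) \<le> (\<Sum>i=1..m. 2 * (1 - p i) ^ ?k)"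
  proof (rule sum_mono)
    fix i assume i: "i \<in> {1..m}"
    have "prob (?U i) \<le> prob (?B {1..?k} i) + prob (?B {?k<..n} i)"
      by (rule measure_Un_le; rule B; auto)
    moreover have "prob (?B {1..?k} i) \<le> (1 - p i) ^ ?k" "prob (?B {?k<..n} i) \<le> (1 - p i) ^ ?k"
      by (rule pB; use i in auto)+
    ultimately show "prob (?U i) \<le> 2 * (1 - p i) ^ ?k"
      by linarith
  qed
  have "1 - prob ?G \<le> (\<Sum>i=1..m. 2 * (1 - p i) ^ ?k)"
    unfolding prob_compl[OF G, symmetric] by (rule order_trans[OF 1 order_trans[OF 2 3]])
  then show ?thesis
    unfolding sum_distrib_left by linarith
qed

section \<open>Passage to the limit\<close>

theorem mainTheorem7:
  fixes m :: nat and p :: "nat \<Rightarrow> real"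
    and M :: "nat \<Rightarrow> 'a measure" and Y :: "nat \<Rightarrow> nat \<Rightarrow> 'a \<Rightarrow> nat"
    and N :: "nat \<Rightarrow> 'a \<Rightarrow> nat set set" and \<omega> :: "nat \<Rightarrow> 'a \<Rightarrow> nat"
  assumes "m \<ge> 1"
    and "\<And>i. i \<in> {1..m} \<Longrightarrow> p i > 0"
    and "(\<Sum>i=1..m. p i) = 1"
    and "\<And>n. n \<ge> 1 \<Longrightarrow> prob_space (M n)"
    and "\<And>n. n \<ge> 1 \<Longrightarrow>
           prob_space.indep_vars (M n) (\<lambda>_. count_space {1..m}) (Y n) {1..n}"
    and "\<And>n j i. n \<ge> 1 \<Longrightarrow> j \<in> {1..n} \<Longrightarrow> i \<in> {1..m} \<Longrightarrow>
           \<P>(x in M n. Y n j x = i) = p i"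
  defines "N \<equiv> \<lambda>n x. empirical_nerve m n (\<lambda>j. Y n j x)"
    and "\<omega> \<equiv> \<lambda>n x. clique_number (skeleton1 (N n x))"
  shows "(\<lambda>n. \<integral>x. real (\<omega> n x) \<partial>M n) \<longlonglongrightarrow> real m
       \<and> converges_in_prob_to_const M (\<lambda>n x. real (\<omega> n x)) (real m)
       \<and> (\<lambda>n. \<P>(x in M n. N n x = full_simplex {1..m})) \<longlonglongrightarrow> 1
       \<and> (\<lambda>n. \<P>(x in M n. skeleton1 (N n x) = complete_graph_on {1..m})) \<longlonglongrightarrow> 1"
proof -
  define g where "g = (\<lambda>n. \<P>(x in M n. N n x = full_simplex {1..m}))"
  have Y: "Y n j \<in> M n \<rightarrow>\<^sub>M count_space {1..m}" if "n \<ge> 1" "j \<in> {1..n}" for n j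
    using assms(4,5)[OF that(1)] that by (auto simp: prob_space.indep_vars_def2)
  \<comment> \<open>\<open>H\<close> stays arbitrary so that one fact serves both for events about
    the nerve and for the clique number.\<close>
  have meas: "(\<lambda>x. H (N n x)) \<in> M n \<rightarrow>\<^sub>M count_space UNIV" if "n \<ge> 1" for n and H :: "nat set set \<Rightarrow> 'c"
    unfolding N_def
  proof (rule measurable_function_of_finitely_many_discrete
      [where J = "{1..n}" and S = "{1..m}" and F = "\<lambda>y. H (empirical_nerve m n y)"])
    show "Y n j \<in> M n \<rightarrow>\<^sub>M count_space {1..m}" if "j \<in> {1..n}" for j
      by (rule Y[OF \<open>n \<ge> 1\<close> that])
    show "H (empirical_nerve m n y) = H (empirical_nerve m n y')"
      if "\<And>j. j \<in> {1..n} \<Longrightarrow> y j = y' j" for y y'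
      by (rule arg_cong[where f = H], rule empirical_nerve_cong, rule that)
  qed simp_all
  have sets: "{x \<in> space (M n). H (N n x)} \<in> sets (M n)" if "n \<ge> 1" for n H
    using meas[OF that, of H] by (auto simp: pred_def)
  have \<omega>_le: "\<omega> n x \<le> m" for n x
    unfolding \<omega>_def N_def by (rule clique_number_empirical_nerve_le)
  have \<omega>_full: "\<omega> n x = m" if "N n x = full_simplex {1..m}" for n x
    using that by (simp add: \<omega>_def skeleton1_full_simplex clique_number_complete_graph_on)
  have g_le: "g n \<le> 1" if "n \<ge> 1" for n
    using prob_space.prob_le_1[OF assms(4)[OF that]] by (simp add: g_def)
  have p_le: "p i \<le> 1" if "i \<in> {1..m}" for i
    using member_le_sum[of i "{1..m}" p] assms(2,3) that by (simp add: less_imp_le)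
  have "(\<lambda>n. 1 - 2 * (\<Sum>i=1..m. (1 - p i) ^ (n div 2))) \<longlonglongrightarrow> 1 - 2 * (\<Sum>i=1..m. 0)"
  proof (intro tendsto_intros)
    fix i assume i: "i \<in> {1..m}"
    have "filterlim (\<lambda>n::nat. n div 2) at_top at_top"
      by (rule filterlim_at_top_div_const_nat) simp
    \<comment> \<open>The base lies in \<open>[0, 1)\<close>: positivity of \<open>p i\<close> gives
      the strict upper bound, \<open>p_le\<close> the lower one.\<close>
    moreover have "(\<lambda>n. (1 - p i) ^ n) \<longlonglongrightarrow> 0"
      using assms(2)[OF i] p_le[OF i] by (intro LIMSEQ_power_zero) simp
    ultimately show "(\<lambda>n. (1 - p i) ^ (n div 2)) \<longlonglongrightarrow> 0"
      by (rule filterlim_compose[rotated])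
  qed
  then have lower: "(\<lambda>n. 1 - 2 * (\<Sum>i=1..m. (1 - p i) ^ (n div 2))) \<longlonglongrightarrow> 1"
    by simp
  have ge: "1 - 2 * (\<Sum>i=1..m. (1 - p i) ^ (n div 2)) \<le> g n" if "n \<ge> 1" for n
    unfolding g_def N_def using assms(1,5,6) that
    by (intro prob_space.prob_empirical_nerve_full_ge[OF assms(4)]) auto
  \<comment> \<open>The squeeze holds only from \<open>n = 1\<close> on, because \<open>M 0\<close>
    is not assumed to be a probability space.\<close>
  have g: "g \<longlonglongrightarrow> 1"
    by (rule tendsto_sandwich[OF _ _ lower tendsto_const])
      (use ge g_le in \<open>auto intro: eventually_sequentiallyI[of 1]\<close>)
  have "(\<lambda>n. \<P>(x in M n. skeleton1 (N n x) = complete_graph_on {1..m})) \<longlonglongrightarrow> 1"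
  proof (rule tendsto_sandwich[OF _ _ g tendsto_const]; rule eventually_sequentiallyI[of 1])
    fix n :: nat assume n: "1 \<le> n"
    interpret prob_space "M n" by (rule assms(4)[OF n])
    \<comment> \<open>Inclusion of events: a full nerve has a complete graph.\<close>
    show "g n \<le> \<P>(x in M n. skeleton1 (N n x) = complete_graph_on {1..m})"
      unfolding g_def
      by (intro finite_measure_mono sets[OF n]) (auto simp: skeleton1_full_simplex)
    show "\<P>(x in M n. skeleton1 (N n x) = complete_graph_on {1..m}) \<le> 1"
      by (rule prob_le_1)
  qed
  moreover have "(\<lambda>n. \<integral>x. real (\<omega> n x) \<partial>M n) \<longlonglongrightarrow> real m"
  proof (rule tendsto_sandwich; (rule eventually_sequentiallyI[of 1])?)
    show "(\<lambda>n. real m * g n) \<longlonglongrightarrow> real m"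
      using tendsto_mult_left[OF g, of "real m"] by simp
    fix n :: nat assume n: "1 \<le> n"
    interpret prob_space "M n" by (rule assms(4)[OF n])
    let ?G = "{x \<in> space (M n). N n x = full_simplex {1..m}}"
    have G: "?G \<in> events" by (rule sets[OF n])
    have "(\<lambda>x. real (\<omega> n x)) \<in> borel_measurable (M n)"
      unfolding \<omega>_def using meas[OF n] by (rule measurable_compose) simp
    then have int: "integrable (M n) (\<lambda>x. real (\<omega> n x))"
      by (rule integrable_const_bound[of _ "real m", rotated]) (simp add: \<omega>_le)
    \<comment> \<open>Integrates the pointwise bound
      \<open>real m * indicator ?G x \<le> real (\<omega> n x)\<close>: on \<open>?G\<close> both
      sides equal \<open>m\<close>, elsewhere the left side is 0.\<close>
    have "real m * g n = (\<integral>x. real m * indicator ?G x \<partial>M n)"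
      using G by (simp add: g_def)
    also have "\<dots> \<le> (\<integral>x. real (\<omega> n x) \<partial>M n)"
    proof (rule integral_mono[OF _ int])
      show "integrable (M n) (\<lambda>x. real m * indicator ?G x)"
        using G by (intro integrable_mult_right integrable_real_indicator) (simp_all add: emeasure_eq_measure)
      show "real m * indicator ?G x \<le> real (\<omega> n x)" for x
        by (simp add: indicator_def \<omega>_full)
    qed
    finally show "real m * g n \<le> (\<integral>x. real (\<omega> n x) \<partial>M n)" .
    show "(\<integral>x. real (\<omega> n x) \<partial>M n) \<le> real m"
      by (intro integral_le_const int) (simp add: \<omega>_le)
  qed simp
  moreover have "converges_in_prob_to_const M (\<lambda>n x. real (\<omega> n x)) (real m)"
    unfolding converges_in_prob_to_const_def
  proof (intro conjI allI impI)
    fix n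
    show "(\<lambda>x. real (\<omega> n x)) \<in> borel_measurable (M n)"
    proof (cases "n \<ge> 1")
      case True
      show ?thesis
        unfolding \<omega>_def using meas[OF True] by (rule measurable_compose) simp
    next
      case False
      \<comment> \<open>\<open>M 0\<close> is an arbitrary measure, but the empty sample has a constant nerve.\<close>
      then have "N n x = empirical_nerve m n (\<lambda>_. 0)" for x
        unfolding N_def by (intro empirical_nerve_cong) simp
      then show ?thesis
        by (simp add: \<omega>_def)
    qed
  next
    fix \<epsilon> :: real assume \<epsilon>: "\<epsilon> > 0"
    have lim: "(\<lambda>n. 1 - g n) \<longlonglongrightarrow> 0"
      using tendsto_diff[OF tendsto_const g, of 1] by simp
    show "(\<lambda>n. \<P>(x in M n. \<bar>real (\<omega> n x) - real m\<bar> > \<epsilon>)) \<longlonglongrightarrow> 0"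
    proof (rule tendsto_sandwich[OF _ _ tendsto_const lim]; rule eventually_sequentiallyI[of 1])
      fix n :: nat assume n: "1 \<le> n"
      interpret prob_space "M n" by (rule assms(4)[OF n])
      let ?G = "{x \<in> space (M n). N n x = full_simplex {1..m}}"
      have G: "?G \<in> events" by (rule sets[OF n])
      \<comment> \<open>On \<open>?G\<close> the deviation is exactly 0, so the bound is the same
        for every \<epsilon>.\<close>
      have "\<P>(x in M n. \<bar>real (\<omega> n x) - real m\<bar> > \<epsilon>) \<le> prob (space (M n) - ?G)"
        using \<epsilon> G by (intro finite_measure_mono) (auto simp: \<omega>_full)
      then show "\<P>(x in M n. \<bar>real (\<omega> n x) - real m\<bar> > \<epsilon>) \<le> 1 - g n"
        using prob_compl[OF G] by (simp add: g_def)
    qed simp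
  qed
  ultimately show ?thesis
    using g by (simp add: g_def)
qed

end
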